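(* Let $G$ be a graph on $n$ vertices and $m$ edges. Then $$b(G)\le \frac{m}{n-1}.$$ Furthermore, equality holds if and only if $G\cong K_n$.
   Context: Graphs are finite, simple, undirected and unweighted. For a graph $G$ with vertex set $V(G)$, $|V(G)|=n\ge 2$, and edge set $E(G)$, the $\ell_1$-Fiedler value is $$b(G)=\min\Big\{\sum_{uv\in E(G)}|x_u-x_v| : x\in\mathbb{R}^{V(G)},\ \sum_{v\in V(G)}x_v=0,\ \sum_{v\in V(G)}|x_v|=1\Big\}.$$ $K_n$ is the complete graph on $n$ vertices.
   Formalization: The equality characterization is stated only for graphs with at least one edge (m > 0), since every edgeless graph on n ≥ 2 vertices has b(G) = 0 = m/(n-1) without being isomorphic to K_n. *)

theory Defs
  imports "HOL-Analysis.Analysis" "Graph_Theory.Digraph_Isomorphism" "Graph_Theory.Kuratowski"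
begin

text \<open>
  Following \<^locale>\<open>graph\<close>, a finite simple graph is a finite loop-free symmetric digraph without
  parallel arcs, so every edge occurs as two opposite arcs. The set of undirected edges has each
  edge once, as the two-element set of its ends.
\<close>

definition edges :: "('a, 'b) pre_digraph \<Rightarrow> 'a set set" where
  "edges G = {{u, v} | u v. (u, v) \<in> arcs_ends G}"

definition edge_diff :: "('a \<Rightarrow> real) \<Rightarrow> 'a set \<Rightarrow> real" where
  "edge_diff x e = Max (x ` e) - Min (x ` e)"

lemma edge_diff_eq: "edge_diff x {u, v} = \<bar>x u - x v\<bar>"
  by (auto simp: edge_diff_def max_def min_def)

text \<open>
  Vectors indexed by the vertices are total functions; their values outside \<^term>\<open>verts G\<close> enter
  neither the constraints nor the objective.
\<close>

definition feasible :: "('a, 'b) pre_digraph \<Rightarrow> ('a \<Rightarrow> real) set" where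
  "feasible G = {x. (\<Sum>v\<in>verts G. x v) = 0 \<and> (\<Sum>v\<in>verts G. \<bar>x v\<bar>) = 1}"

definition variation :: "('a, 'b) pre_digraph \<Rightarrow> ('a \<Rightarrow> real) \<Rightarrow> real" where
  "variation G x = (\<Sum>e\<in>edges G. edge_diff x e)"

text \<open>
  The infimum is a minimum as soon as there are two vertices, see \<open>l1_fiedler_attained\<close> below.
\<close>

definition l1_fiedler :: "('a, 'b) pre_digraph \<Rightarrow> real" where
  "l1_fiedler G = (INF x\<in>feasible G. variation G x)"

definition complete_graph :: "nat \<Rightarrow> nat pair_pre_digraph" where
  "complete_graph n = \<lparr>pverts = {..<n}, parcs = {(u, v). u < n \<and> v < n \<and> u \<noteq> v}\<rparr>"

lemma complete_graph_complete: "complete_digraph n (with_proj (complete_graph n))"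
  unfolding complete_digraph_pair_def by (auto simp: complete_graph_def)

lemma variation_cong:
  assumes "graph G" "\<And>v. v \<in> verts G \<Longrightarrow> x v = y v"
  shows "variation G x = variation G y"
proof -
  interpret graph G by fact
  have "x ` e = y ` e" if "e \<in> edges G" for e
    using that assms(2) adj_in_verts by (fastforce simp: edges_def)
  then show ?thesis by (simp add: variation_def edge_diff_def)
qed

lemma feasible_nonempty:
  assumes "graph G" "card (verts G) \<ge> 2"
  shows "feasible G \<noteq> {}"
proof -
  interpret graph G by fact
  obtain u v where uv: "u \<in> verts G" "v \<in> verts G" "u \<noteq> v"
    using assms(2) by (auto simp: numeral_2_eq_2 card_le_Suc_iff)
  define x :: "'a \<Rightarrow> real" where "x w = (if w = u then 1/2 else 0) - (if w = v then 1/2 else 0)" for w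
  have "\<bar>x w\<bar> = (if w = u then 1/2 else 0) + (if w = v then 1/2 else 0)" for w
    using uv by (simp add: x_def)
  then have "x \<in> feasible G"
    using uv by (simp add: feasible_def x_def sum.distrib sum_subtractf)
  then show ?thesis by blast
qed

lemma l1_fiedler_attained:
  assumes "graph G" "card (verts G) \<ge> 2"
  obtains x where "x \<in> feasible G" "l1_fiedler G = variation G x"
    "\<And>y. y \<in> feasible G \<Longrightarrow> variation G x \<le> variation G y"
proof -
  interpret graph G by fact
  define B where "B = PiE UNIV (\<lambda>v. if v \<in> verts G then {-1..1::real} else {0})"
  have "compactin (product_topology (\<lambda>v. euclidean) UNIV) B"
    unfolding B_def compactin_PiE by auto
  then have "compact B" by (simp add: euclidean_product_topology)
  have cont: "continuous_on UNIV (\<lambda>x::'a \<Rightarrow> real. x v)" for v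
    by (rule continuous_on_product_coordinates)
  have eq: "feasible G = (\<lambda>x. \<Sum>v\<in>verts G. x v) -` {0} \<inter> (\<lambda>x. \<Sum>v\<in>verts G. \<bar>x v\<bar>) -` {1}"
    by (auto simp: feasible_def)
  have "closed (feasible G)"
    unfolding eq
    by (intro closed_Int closed_vimage continuous_on_sum continuous_on_rabs cont closed_singleton)
  with \<open>compact B\<close> have comp: "compact (B \<inter> feasible G)" by (rule compact_Int_closed)
  have trunc: "\<exists>y\<in>B \<inter> feasible G. variation G y = variation G x" if "x \<in> feasible G" for x
  proof -
    define y where "y v = (if v \<in> verts G then x v else 0)" for v
    have "\<bar>x v\<bar> \<le> 1" if "v \<in> verts G" for v
      using member_le_sum[OF that, of "\<lambda>v. \<bar>x v\<bar>"] \<open>x \<in> feasible G\<close> by (simp add: feasible_def)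
    then have "y \<in> B" by (auto simp: B_def y_def abs_le_iff minus_le_iff)
    moreover have "y \<in> feasible G" using that by (simp add: feasible_def y_def)
    moreover have "variation G y = variation G x"
      by (rule variation_cong[OF assms(1)]) (simp add: y_def)
    ultimately show ?thesis by blast
  qed
  have "continuous_on (B \<inter> feasible G) (variation G)"
    unfolding variation_def
  proof (rule continuous_on_sum)
    fix e assume "e \<in> edges G"
    then obtain u v where "e = {u, v}" by (auto simp: edges_def)
    then show "continuous_on (B \<inter> feasible G) (\<lambda>x. edge_diff x e)"
      by (simp add: edge_diff_eq)
        (intro continuous_on_rabs continuous_on_diff continuous_on_subset[OF cont] subset_UNIV)
  qed
  moreover have "B \<inter> feasible G \<noteq> {}" using trunc feasible_nonempty[OF assms] by blast
  ultimately obtain x where x: "x \<in> B \<inter> feasible G"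
    and min: "\<And>y. y \<in> B \<inter> feasible G \<Longrightarrow> variation G x \<le> variation G y"
    using continuous_attains_inf[OF comp] by blast
  have least: "variation G x \<le> variation G y" if "y \<in> feasible G" for y
    using trunc[OF that] min by force
  have "l1_fiedler G = variation G x"
    unfolding l1_fiedler_def using x least by (intro cInf_eq_minimum) auto
  with x least that show thesis by blast
qed

text \<open>
  An edgeless graph on at least two vertices attains equality in the upper bound without being
  complete, so a characterization of equality by completeness needs at least one edge.
\<close>

lemma edgeless_equality:
  assumes "graph G" "card (verts G) = n" "n \<ge> 2" "card (edges G) = 0"
  shows "l1_fiedler G = real (card (edges G)) / (real n - 1)"
    and "\<not> digraph_iso G (with_proj (complete_graph n))"
proof -
  interpret graph G by fact
  have "edges G = (\<lambda>(u, v). {u, v}) ` arcs_ends G" by (auto simp: edges_def)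
  moreover have "finite (arcs_ends G)" by (simp add: arcs_ends_def)
  ultimately have "edges G = {}" and no_ends: "arcs_ends G = {}" using assms(4) by auto
  then show "l1_fiedler G = real (card (edges G)) / (real n - 1)"
    using feasible_nonempty[OF assms(1)] assms(2,3) by (simp add: l1_fiedler_def variation_def)
  have "arcs G = {}" using no_ends by (simp add: arcs_ends_def)
  moreover have "(0, 1) \<in> arcs (with_proj (complete_graph n))"
    using assms(3) by (simp add: complete_graph_def)
  ultimately show "\<not> digraph_iso G (with_proj (complete_graph n))"
    by (metis arcs_app_iso digraph_iso_def empty_iff image_empty)
qed

end

theory Submission
  imports Defs
begin

text \<open>
  For a proper nonempty set \<open>S\<close> of \<open>s\<close> vertices, the vector equal to \<open>1/(2s)\<close> on \<open>S\<close> and to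
  \<open>-1/(2(n-s))\<close> elsewhere shows \<open>b(G) \<le> n c(S) / (2s(n-s))\<close>, with \<open>c(S)\<close> the number of edges leaving
  \<open>S\<close>. Averaging over the singletons \<open>S = {v}\<close> gives \<open>b(G) \<le> m/(n-1)\<close>, and equality forces \<open>G\<close> to be
  regular of some degree \<open>d\<close>. If then there is an edge \<open>uv\<close>, the cut of \<open>S = {u, v}\<close> has \<open>2d - 2\<close>
  edges, and comparing its bound with \<open>m/(n-1) = nd/(2(n-1))\<close> yields \<open>d \<ge> n - 1\<close> when \<open>n > 2\<close>. Conversely, if
  \<open>\<Sum>x = 0\<close> then \<open>\<Sum>\<^sub>v \<bar>x\<^sub>u - x\<^sub>v\<bar> \<ge> \<bar>n x\<^sub>u\<bar>\<close> for each \<open>u\<close>, so the variation on \<open>K\<^sub>n\<close> is at least \<open>n/2\<close>.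
\<close>

context graph
begin

section \<open>Adjacent ordered pairs and undirected edges\<close>

lemma finite_arcs_ends: "finite (arcs_ends G)"
  by (simp add: arcs_ends_def)

lemma arcs_ends_subset: "arcs_ends G \<subseteq> verts G \<times> verts G"
  using adj_in_verts by auto

lemma arcs_ends_irrefl: "(u, u) \<notin> arcs_ends G"
  by (auto simp: arcs_ends_conv dest: no_loops)

lemma arcs_ends_symD: "(u, v) \<in> arcs_ends G \<Longrightarrow> (v, u) \<in> arcs_ends G"
  using sym_arcs by (auto simp: symmetric_def dest: symD)

lemma neighbours_subset: "arcs_ends G `` {v} \<subseteq> verts G - {v}"
  using arcs_ends_subset arcs_ends_irrefl by auto

text \<open>Grouping the adjacent ordered pairs by the edge they span, each fibre consists of
  exactly two pairs, since there are no loops. This lets later sums run over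
  \<open>arcs_ends G\<close>, with a factor 2.\<close>

lemma sum_arcs_ends_eq_edges:
  fixes f :: "'a set \<Rightarrow> real"
  shows "(\<Sum>(u, v)\<in>arcs_ends G. f {u, v}) = 2 * (\<Sum>e\<in>edges G. f e)"
proof -
  let ?h = "\<lambda>(u, v). {u, v}"
  have im: "?h ` arcs_ends G = edges G"
    by (auto simp: edges_def)
  have "(\<Sum>p\<in>arcs_ends G. f (?h p)) = (\<Sum>e\<in>edges G. \<Sum>p | p \<in> arcs_ends G \<and> ?h p = e. f (?h p))"
    using sum.image_gen[OF finite_arcs_ends, of "\<lambda>p. f (?h p)" ?h] by (simp add: im)
  also have "\<dots> = (\<Sum>e\<in>edges G. 2 * f e)"
  proof (rule sum.cong[OF refl])
    fix e assume "e \<in> edges G"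
    then obtain u v where uv: "e = {u, v}" "(u, v) \<in> arcs_ends G"
      by (auto simp: edges_def)
    then have "u \<noteq> v" using arcs_ends_irrefl by auto
    moreover have "{p \<in> arcs_ends G. ?h p = e} = {(u, v), (v, u)}"
      using uv arcs_ends_symD by (auto simp: doubleton_eq_iff)
    ultimately show "(\<Sum>p | p \<in> arcs_ends G \<and> ?h p = e. f (?h p)) = 2 * f e"
      using uv by (simp add: insert_commute)
  qed
  finally show ?thesis
    by (simp add: sum_distrib_left case_prod_unfold)
qed

lemma card_arcs_ends: "card (arcs_ends G) = 2 * card (edges G)"
proof -
  have "real (card (arcs_ends G)) = real (2 * card (edges G))"
    using sum_arcs_ends_eq_edges[of "\<lambda>_. 1"] by simp
  then show ?thesis by linarith
qed

lemma variation_eq: "variation G x = (\<Sum>(u, v)\<in>arcs_ends G. \<bar>x u - x v\<bar>) / 2"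
  using sum_arcs_ends_eq_edges[of "edge_diff x"] by (simp add: variation_def edge_diff_eq)

lemma card_arcs_ends_eq_sum_degrees:
  "card (arcs_ends G) = (\<Sum>v\<in>verts G. card (arcs_ends G `` {v}))"
proof -
  have "arcs_ends G = Sigma (verts G) (\<lambda>v. arcs_ends G `` {v})"
    using arcs_ends_subset by auto
  moreover have "finite (arcs_ends G `` {v})" for v
    using finite_subset[OF neighbours_subset] by simp
  ultimately show ?thesis
    using card_SigmaI[of "verts G" "\<lambda>v. arcs_ends G `` {v}"] by simp
qed

section \<open>Upper bounds from cuts\<close>

lemma l1_fiedler_le_cut:
  assumes "S \<subseteq> verts G" "S \<noteq> {}" "S \<noteq> verts G"
  shows "l1_fiedler G \<le> real (card (verts G)) * real (card (arcs_ends G \<inter> S \<times> - S)) /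
    (2 * real (card S) * (real (card (verts G)) - real (card S)))"
proof -
  define n s where "n = real (card (verts G))" and "s = real (card S)"
  have fin: "finite S" using finite_subset[OF assms(1)] by simp
  have s: "s > 0" "s < n"
    using assms fin psubset_card_mono[of "verts G" S] by (auto simp: s_def n_def card_gt_0_iff)
  define x where "x v = (if v \<in> S then 1 / (2 * s) else - 1 / (2 * (n - s)))" for v
  have rest: "real (card (verts G - S)) = n - s"
    using card_Diff_subset[OF fin assms(1)] card_mono[OF finite_verts assms(1)]
    by (simp add: n_def s_def of_nat_diff)
  have split: "sum g (verts G) = sum g S + sum g (verts G - S)" for g :: "'a \<Rightarrow> real"
    by (subst sum.subset_diff[OF assms(1)]) simp_all
  have S: "(\<Sum>v\<in>S. x v) = 1/2" "(\<Sum>v\<in>S. \<bar>x v\<bar>) = 1/2"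
    using s by (simp_all add: x_def flip: s_def)
  have "(\<Sum>v\<in>verts G - S. x v) = (\<Sum>v\<in>verts G - S. - 1 / (2 * (n - s)))"
    by (rule sum.cong) (auto simp: x_def)
  also have "\<dots> = - 1/2" using s by (simp add: rest field_simps)
  finally have T: "(\<Sum>v\<in>verts G - S. x v) = - 1/2" .
  have "(\<Sum>v\<in>verts G - S. \<bar>x v\<bar>) = (\<Sum>v\<in>verts G - S. 1 / (2 * (n - s)))"
    using s by (intro sum.cong) (auto simp: x_def)
  also have "\<dots> = 1/2" using s by (simp add: rest field_simps)
  finally have "(\<Sum>v\<in>verts G - S. \<bar>x v\<bar>) = 1/2" .
  with S T have feas: "x \<in> feasible G"
    by (simp add: feasible_def split)
  define c where "c = card (arcs_ends G \<inter> S \<times> - S)"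
  \<comment> \<open>\<open>D\<close> is the jump of \<open>x\<close> across the cut, that is, the
    difference of its two values.\<close>
  define D where "D = n / (2 * s * (n - s))"
  have D: "D = 1 / (2 * s) + 1 / (2 * (n - s))" "D > 0"
    using s by (simp_all add: D_def field_simps)
  have "x u - x v = D * of_bool ((u, v) \<in> S \<times> - S) - D * of_bool ((u, v) \<in> (- S) \<times> S)" for u v
    by (simp add: x_def D(1))
  then have diff: "\<bar>x u - x v\<bar> =
      D * of_bool ((u, v) \<in> S \<times> - S) + D * of_bool ((u, v) \<in> (- S) \<times> S)" for u v
    using D(2) by (auto simp: of_bool_def)
  \<comment> \<open>Reversing pairs matches those entering \<open>S\<close> with those leaving it.
    The resulting factor 2 cancels the 2 in \<open>variation_eq\<close>.\<close>
  have "arcs_ends G \<inter> (- S) \<times> S = (\<lambda>(u, v). (v, u)) ` (arcs_ends G \<inter> S \<times> - S)"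
    using arcs_ends_symD by force
  then have c': "card (arcs_ends G \<inter> (- S) \<times> S) = c"
    unfolding c_def by (simp only:) (rule card_image, auto intro: inj_onI)
  have ind: "(\<Sum>p\<in>arcs_ends G. D * of_bool (p \<in> A)) = D * real (card (arcs_ends G \<inter> A))" for A
    using finite_arcs_ends
    by (simp add: sum_distrib_left[symmetric] of_bool_def sum.If_cases Int_def)
  have "(\<Sum>(u, v)\<in>arcs_ends G. \<bar>x u - x v\<bar>) =
      (\<Sum>p\<in>arcs_ends G. D * of_bool (p \<in> S \<times> - S) + D * of_bool (p \<in> (- S) \<times> S))"
    by (rule sum.cong) (auto simp only: diff split: prod.split)
  also have "\<dots> = 2 * (D * real c)"
    by (simp only: sum.distrib ind c' c_def[symmetric])
  finally have "variation G x = D * real c"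
    by (simp add: variation_eq)
  \<comment> \<open>An infimum of reals lies below each member only if the set is bounded
    below.\<close>
  moreover have "bdd_below (variation G ` feasible G)"
    by (rule bdd_belowI[of _ 0]) (auto simp: variation_eq intro!: sum_nonneg)
  ultimately have "l1_fiedler G \<le> D * real c"
    using cINF_lower[OF _ feas, of "variation G"] by (simp add: l1_fiedler_def)
  then show ?thesis by (simp add: D_def c_def n_def s_def)
qed

lemma l1_fiedler_le_degree:
  assumes "v \<in> verts G" "card (verts G) \<ge> 2"
  shows "l1_fiedler G \<le> real (card (verts G)) * real (card (arcs_ends G `` {v})) /
    (2 * (real (card (verts G)) - 1))"
proof -
  have "arcs_ends G \<inter> {v} \<times> - {v} = Pair v ` (arcs_ends G `` {v})"
    using arcs_ends_irrefl by auto
  then have "card (arcs_ends G \<inter> {v} \<times> - {v}) = card (arcs_ends G `` {v})"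
    by (simp add: card_image inj_on_def)
  moreover have "card {v} \<noteq> card (verts G)" using assms(2) by simp
  then have "{v} \<noteq> verts G" by metis
  ultimately show ?thesis using l1_fiedler_le_cut[of "{v}"] assms(1) by simp
qed

text \<open>This is the cut bound for \<open>{u, v}\<close>. The edge between \<open>u\<close> and
  \<open>v\<close> does not cross the cut but is counted in both degrees, hence the
  \<open>- 2\<close>. More than two vertices are required for \<open>{u, v}\<close> to be a proper
  subset.\<close>

lemma l1_fiedler_le_adjacent:
  assumes uv: "(u, v) \<in> arcs_ends G" and n: "card (verts G) > 2"
  shows "l1_fiedler G \<le>
    real (card (verts G)) * (real (card (arcs_ends G `` {u})) + real (card (arcs_ends G `` {v})) - 2) /
    (4 * (real (card (verts G)) - 2))"
proof -
  have ne: "u \<noteq> v" using uv arcs_ends_irrefl by auto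
  have vu: "(v, u) \<in> arcs_ends G" using uv arcs_ends_symD by blast
  have fin: "finite (arcs_ends G `` {w})" for w
    using finite_subset[OF neighbours_subset] by simp
  let ?U = "arcs_ends G `` {u} - {v}" and ?V = "arcs_ends G `` {v} - {u}"
  have "arcs_ends G \<inter> {u, v} \<times> - {u, v} = Pair u ` ?U \<union> Pair v ` ?V"
    using arcs_ends_irrefl by auto
  moreover have "card (Pair u ` ?U \<union> Pair v ` ?V) = card ?U + card ?V"
    using fin ne by (subst card_Un_disjoint) (auto simp: card_image inj_on_def)
  moreover have "card (arcs_ends G `` {u}) = Suc (card ?U)" "card (arcs_ends G `` {v}) = Suc (card ?V)"
    using card.remove[OF fin, of v u] card.remove[OF fin, of u v] uv vu by auto
  moreover have "card {u, v} \<noteq> card (verts G)" using n ne by simp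
  then have "{u, v} \<noteq> verts G" by metis
  ultimately show ?thesis
    using l1_fiedler_le_cut[of "{u, v}"] adj_in_verts[OF uv] ne by simp
qed

lemma l1_fiedler_le:
  assumes "card (verts G) \<ge> 2"
  shows "l1_fiedler G \<le> real (card (edges G)) / (real (card (verts G)) - 1)"
    and "l1_fiedler G = real (card (edges G)) / (real (card (verts G)) - 1) \<Longrightarrow> v \<in> verts G \<Longrightarrow>
      real (card (verts G)) * real (card (arcs_ends G `` {v})) = 2 * real (card (edges G))"
proof -
  define n m b where "n = real (card (verts G))" and "m = real (card (edges G))" and "b = l1_fiedler G"
  define d where "d v = real (card (arcs_ends G `` {v}))" for v
  have n: "n \<ge> 2" using assms by (simp add: n_def)
  have le: "b * (2 * (n - 1)) \<le> n * d v" if "v \<in> verts G" for v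
    using l1_fiedler_le_degree[OF that assms] n
    by (simp add: n_def[symmetric] b_def[symmetric] d_def[symmetric] field_simps)
  have "(\<Sum>v\<in>verts G. d v) = 2 * m"
    using card_arcs_ends card_arcs_ends_eq_sum_degrees
    by (simp add: d_def m_def flip: of_nat_sum)
  \<comment> \<open>The slacks in the singleton bounds are nonnegative. Their total gives the upper
    bound on \<open>b\<close>, and when it vanishes every slack vanishes, so all degrees
    agree.\<close>
  then have total: "(\<Sum>v\<in>verts G. n * d v - b * (2 * (n - 1))) = 2 * n * (m - b * (n - 1))"
    by (simp add: sum_subtractf flip: sum_distrib_left) (simp add: n_def algebra_simps)
  have nonneg: "0 \<le> n * d v - b * (2 * (n - 1))" if "v \<in> verts G" for v
    using le[OF that] by simp
  have "0 \<le> 2 * n * (m - b * (n - 1))"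
    unfolding total[symmetric] by (intro sum_nonneg nonneg)
  then have "b * (n - 1) \<le> m" using n by (simp add: zero_le_mult_iff)
  then show "l1_fiedler G \<le> real (card (edges G)) / (real (card (verts G)) - 1)"
    using n by (simp add: n_def[symmetric] b_def[symmetric] m_def[symmetric] field_simps)
  assume "l1_fiedler G = real (card (edges G)) / (real (card (verts G)) - 1)" and v: "v \<in> verts G"
  then have eq: "b * (n - 1) = m"
    using n by (simp add: n_def[symmetric] b_def[symmetric] m_def[symmetric])
  with total have "(\<Sum>v\<in>verts G. n * d v - b * (2 * (n - 1))) = 0" by simp
  then have "n * d v - b * (2 * (n - 1)) = 0"
    using v nonneg by (subst (asm) sum_nonneg_eq_0_iff) auto
  with eq have "n * d v = 2 * m" by (simp add: algebra_simps)
  then show "real (card (verts G)) * real (card (arcs_ends G `` {v})) = 2 * real (card (edges G))"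
    by (simp add: n_def d_def m_def)
qed

section \<open>The equality case\<close>

lemma complete_if_l1_fiedler_eq:
  assumes n2: "card (verts G) \<ge> 2" and "card (edges G) > 0"
    and eq: "l1_fiedler G = real (card (edges G)) / (real (card (verts G)) - 1)"
  shows "complete_digraph (card (verts G)) G"
proof -
  define n m where "n = real (card (verts G))" and "m = real (card (edges G))"
  have reg: "n * real (card (arcs_ends G `` {w})) = 2 * m" if "w \<in> verts G" for w
    using l1_fiedler_le(2)[OF n2 eq that] by (simp add: n_def m_def)
  have n: "n \<ge> 2" using n2 by (simp add: n_def)
  \<comment> \<open>An edge must be supplied here: edgeless graphs are regular and attain equality
    as well.\<close>
  have "arcs_ends G \<noteq> {}" using card_arcs_ends assms(2) by auto
  then obtain u v where uv: "(u, v) \<in> arcs_ends G" by auto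
  define d where "d = real (card (arcs_ends G `` {u}))"
  have nd: "n * d = 2 * m" using reg adj_in_verts[OF uv] by (simp add: d_def)
  have deg: "real (card (arcs_ends G `` {w})) = d" if "w \<in> verts G" for w
    using reg[OF that] nd n mult_left_cancel[of n _ d] by simp
  have "d \<ge> n - 1"
  \<comment> \<open>With two vertices the ends of an edge exhaust the graph and give no cut, but
    then a single neighbour already suffices.\<close>
  proof (cases "card (verts G) = 2")
    case True
    have "v \<in> arcs_ends G `` {u}" "finite (arcs_ends G `` {u})"
      using uv finite_subset[OF neighbours_subset] by auto
    then have "card (arcs_ends G `` {u}) > 0" by (metis card_gt_0_iff empty_iff)
    then have "d \<ge> 1" by (simp add: d_def)
    then show ?thesis using True by (simp add: n_def)
  next
    case False
    with n2 have "card (verts G) > 2" by simp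
    then have n3: "n > 2" by (simp add: n_def)
    have "m / (n - 1) \<le> n * (d + d - 2) / (4 * (n - 2))"
      using l1_fiedler_le_adjacent[OF uv \<open>card (verts G) > 2\<close>] adj_in_verts[OF uv] deg eq
      by (simp add: n_def[symmetric] m_def[symmetric])
    moreover have "m = n * d / 2" using nd by simp
    ultimately have "n * (d / (n - 1)) \<le> n * ((d - 1) / (n - 2))"
      using n3 by (simp add: field_simps)
    then have "d / (n - 1) \<le> (d - 1) / (n - 2)"
      by (rule mult_left_le_imp_le) (use n3 in simp)
    \<comment> \<open>Cross-multiplying, \<open>d * (n - 2) \<le> (d - 1) * (n - 1)\<close> reduces
      to \<open>n - 1 \<le> d\<close>.\<close>
    then show ?thesis using n3 by (simp add: field_simps)
  qed
  \<comment> \<open>The neighbours of \<open>w\<close> lie in a set of \<open>n - 1\<close>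
    elements, so a degree of at least \<open>n - 1\<close> makes them fill it.\<close>
  have "arcs_ends G `` {w} = verts G - {w}" if "w \<in> verts G" for w
  proof (rule card_seteq)
    have "real (card (verts G - {w})) = n - 1"
      using that n2 by (simp add: n_def of_nat_diff)
    then show "card (verts G - {w}) \<le> card (arcs_ends G `` {w})"
      using \<open>d \<ge> n - 1\<close> deg[OF that] by simp
  qed (use neighbours_subset in auto)
  then have "arcs_ends G = {(u, v). (u, v) \<in> verts G \<times> verts G \<and> u \<noteq> v}"
    using arcs_ends_subset by blast
  then show ?thesis
    using graph_axioms by (simp add: complete_digraph_def)
qed

lemma l1_fiedler_eq_if_complete:
  assumes n2: "card (verts G) \<ge> 2" and "complete_digraph (card (verts G)) G"
  shows "l1_fiedler G = real (card (edges G)) / (real (card (verts G)) - 1)"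
proof (rule antisym)
  define n where "n = real (card (verts G))"
  have ends: "arcs_ends G = (SIGMA u:verts G. verts G - {u})"
    using assms(2) by (auto simp: complete_digraph_def)
  have "card (arcs_ends G) = card (verts G) * (card (verts G) - 1)"
    unfolding ends by (subst card_SigmaI) auto
  then have "real (2 * card (edges G)) = real (card (verts G) * (card (verts G) - 1))"
    by (simp only: card_arcs_ends)
  then have m: "2 * real (card (edges G)) = n * (n - 1)"
    using n2 by (simp add: n_def of_nat_diff)
  have "n / 2 \<le> variation G x" if x: "x \<in> feasible G" for x
  proof -
    have "n = (\<Sum>u\<in>verts G. n * \<bar>x u\<bar>)"
      using x by (simp add: feasible_def flip: sum_distrib_left)
    also have "\<dots> \<le> (\<Sum>u\<in>verts G. \<Sum>v\<in>verts G - {u}. \<bar>x u - x v\<bar>)"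
    proof (rule sum_mono)
      fix u assume u: "u \<in> verts G"
      \<comment> \<open>As the entries of \<open>x\<close> sum to zero, the differences
        \<open>x u - x v\<close> over all \<open>v\<close> sum to \<open>n * x u\<close>.\<close>
      have "n * \<bar>x u\<bar> = \<bar>\<Sum>v\<in>verts G. x u - x v\<bar>"
        using x by (simp add: feasible_def sum_subtractf abs_mult n_def)
      also have "\<dots> \<le> (\<Sum>v\<in>verts G. \<bar>x u - x v\<bar>)" by (rule sum_abs)
      also have "\<dots> = (\<Sum>v\<in>verts G - {u}. \<bar>x u - x v\<bar>)"
        using u by (simp add: sum.remove)
      finally show "n * \<bar>x u\<bar> \<le> (\<Sum>v\<in>verts G - {u}. \<bar>x u - x v\<bar>)" .
    qed
    also have "\<dots> = (\<Sum>(u, v)\<in>arcs_ends G. \<bar>x u - x v\<bar>)"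
      unfolding ends by (subst sum.Sigma) auto
    finally show ?thesis by (simp add: variation_eq)
  qed
  then have "n / 2 \<le> l1_fiedler G"
    unfolding l1_fiedler_def using feasible_nonempty[OF graph_axioms n2] by (rule cINF_greatest[rotated])
  moreover have "real (card (edges G)) / (n - 1) = n / 2"
    using m n2 by (simp add: n_def field_simps)
  ultimately show "real (card (edges G)) / (real (card (verts G)) - 1) \<le> l1_fiedler G"
    unfolding n_def by linarith
qed (rule l1_fiedler_le(1)[OF n2])

section \<open>Completeness as isomorphism with the standard complete graph\<close>

lemma digraph_iso_complete_graph_iff:
  "digraph_iso G (with_proj (complete_graph n)) \<longleftrightarrow> complete_digraph n G"
proof
  assume "digraph_iso G (with_proj (complete_graph n))"
  then obtain f where f: "digraph_isomorphism f" and eq: "with_proj (complete_graph n) = app_iso f G"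
    by (auto simp: digraph_iso_def)
  let ?h = "iso_verts f"
  have inj: "inj_on ?h (verts G)" using f by (rule digraph_isomorphism_inj_on_verts)
  have V: "?h ` verts G = {..<n}"
    using arg_cong[OF eq, of verts] by (simp add: complete_graph_def)
  have A: "(\<lambda>(u, v). (?h u, ?h v)) ` arcs_ends G = {(u, v). u < n \<and> v < n \<and> u \<noteq> v}"
    using arg_cong[OF eq, of arcs_ends] by (simp add: complete_graph_def arcs_ends_app_iso_eq[OF f])
  have "(u, v) \<in> arcs_ends G" if "u \<in> verts G" "v \<in> verts G" "u \<noteq> v" for u v
  proof -
    \<comment> \<open>Distinct vertices have distinct images, which are adjacent in the target;
      injectivity of \<open>?h\<close> on vertices carries the adjacency back.\<close>
    have "(?h u, ?h v) \<in> (\<lambda>(u, v). (?h u, ?h v)) ` arcs_ends G"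
      unfolding A using V inj that by (auto dest: inj_onD)
    then obtain u' v' where "(u', v') \<in> arcs_ends G" "?h u = ?h u'" "?h v = ?h v'" by auto
    then show ?thesis using inj that adj_in_verts by (metis inj_onD)
  qed
  then have "arcs_ends G = {(u, v). (u, v) \<in> verts G \<times> verts G \<and> u \<noteq> v}"
    using arcs_ends_subset arcs_ends_irrefl by auto
  moreover have "card (verts G) = n"
    using card_image[OF inj] by (simp add: V)
  ultimately show "complete_digraph n G"
    using graph_axioms by (simp add: complete_digraph_def)
next
  assume complete: "complete_digraph n G"
  then have ends: "arcs_ends G = {(u, v). (u, v) \<in> verts G \<times> verts G \<and> u \<noteq> v}"
    by (simp add: complete_digraph_def)
  obtain h where "bij_betw h (verts G) {..<n}"
    using complete finite_same_card_bij[of "verts G" "{..<n}"] by (auto simp: complete_digraph_def)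
  then have inj: "inj_on h (verts G)" and V: "h ` verts G = {..<n}"
    by (auto simp: bij_betw_def)
  \<comment> \<open>Arcs of the target are pairs of vertices, so an arc must go to the pair of
    images of its ends. Absence of parallel arcs makes this injective, although completeness only
    constrains the pairs of ends.\<close>
  let ?g = "\<lambda>a. (h (tail G a), h (head G a))"
  have "inj_on ?g (arcs G)"
  proof (rule inj_onI)
    fix a b assume ab: "a \<in> arcs G" "b \<in> arcs G" "?g a = ?g b"
    then have "tail G a = tail G b" "head G a = head G b"
      using inj by (auto dest: inj_onD)
    then show "a = b" using ab no_multi_arcs by (simp add: arc_to_ends_def)
  qed
  moreover have "?g ` arcs G = {(u, v). u < n \<and> v < n \<and> u \<noteq> v}"
  proof -
    have "?g ` arcs G = (\<lambda>(u, v). (h u, h v)) ` arcs_ends G"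
      by (simp add: arcs_ends_conv image_image)
    also have "\<dots> = {(u, v). u \<in> h ` verts G \<and> v \<in> h ` verts G \<and> u \<noteq> v}"
      unfolding ends using inj by (force dest: inj_onD)
    finally show ?thesis by (simp add: V)
  qed
  moreover define f where "f = \<lparr>iso_verts = h, iso_arcs = ?g, iso_head = snd, iso_tail = fst\<rparr>"
  ultimately have "digraph_isomorphism f" "with_proj (complete_graph n) = app_iso f G"
    using inj V wf_digraph by (simp_all add: digraph_isomorphism_def app_iso_def with_proj_def complete_graph_def)
  then show "digraph_iso G (with_proj (complete_graph n))"
    by (auto simp: digraph_iso_def)
qed

end

theorem theorem3p1:
  fixes G :: "('a, 'b) pre_digraph" and n m :: nat
  assumes "graph G"
    and "card (verts G) = n" and "n \<ge> 2"
    and "card (edges G) = m"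
  shows "l1_fiedler G \<le> real m / (real n - 1) \<and>
    (m > 0 \<longrightarrow>
      (l1_fiedler G = real m / (real n - 1) \<longleftrightarrow>
       digraph_iso G (with_proj (complete_graph n))))"
proof -
  interpret graph G by fact
  have n: "card (verts G) \<ge> 2" using assms(2,3) by simp
  show ?thesis
    using l1_fiedler_le(1)[OF n] complete_if_l1_fiedler_eq[OF n] l1_fiedler_eq_if_complete[OF n]
    unfolding digraph_iso_complete_graph_iff assms(2,4) by blast
qed

end
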